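(* Assume $\sigma\in\operatorname{Aut}(R)$, and put $\sigma'=\sigma^{-1}$ and $\delta'=-\sigma^{-1}\delta$. Let $C\subseteq R^n$ be a right $(\sigma,\delta)$-polycyclic code (with respect to $f$). Then $C^{\perp}$ is invariant under the map $v\mapsto \sigma'(v)\,C_{\sigma'(f)}^{t}+\delta'(v)$, where $\sigma'(f)$ is the polynomial obtained by applying $\sigma'$ to the coefficients of $f$ and $t$ denotes transpose. In fact, $C^{\perp}$ is a right $(\sigma',\delta')$-sequential code with respect to $f'$ (i.e. in $S'/S'f'$), where $S'=R^{op}[x,\sigma',\delta']$ and $f'=\sigma'(f)$.
   Context: $R$ is a finite ring with $1\neq 0$, $\sigma$ is a ring endomorphism of $R$ with $\sigma(1)=1$, and $\delta:R\to R$ is a left $\sigma$-derivation: additive with $\delta(ab)=\sigma(a)\delta(b)+\delta(a)b$. $S=R[x,\sigma,\delta]$ is the Ore extension: polynomials with coefficients on the left, usual addition, multiplication determined by $xa=\sigma(a)x+\delta(a)$ and $x^rx^s=x^{r+s}$. $R^{op}$ is the opposite ring. $f(x)=-f_0-f_1x-\cdots-f_{n-1}x^{n-1}+x^n\in S$ is monic. $C_f$ is the $n\times n$ companion matrix whose $i$-th row, for $1\le i\le n-1$, is the $(i+1)$-st standard basis vector, and whose last row is $(f_0,f_1,\ldots,f_{n-1})$. The maps $\sigma,\delta$ (and $\sigma',\delta'$) are applied to vectors entrywise. A left linear code of length $n$ is a left $R$-submodule of $R^n$. A left linear code $C$ is right $(\sigma,\delta)$-polycyclic (with respect to $f$; "in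 $S/Sf$") if for every $g=(g_0,\ldots,g_{n-1})\in C$, $(0,\sigma(g_0),\ldots,\sigma(g_{n-2}))+\sigma(g_{n-1})(f_0,\ldots,f_{n-1})+\delta(g)\in C$. A linear code $C$ is right $(\sigma,\delta)$-sequential (with respect to $f$) if for every $g=(g_0,\ldots,g_{n-1})\in C$, $(\sigma(g_1),\sigma(g_2),\ldots,\sigma(g_{n-1}),\ \sigma(g_0)f_0+\sigma(g_1)f_1+\cdots+\sigma(g_{n-1})f_{n-1})+\delta(g)\in C$; the notion with $(\sigma',\delta')$ and $f'$ is obtained by replacing $\sigma,\delta,f$ accordingly. Standing assumption: the identity map $\operatorname{Id}:R\to R^{op}$ is an anti-automorphism of $R$ (so $ab=ba$ for all $a,b\in R$). The inner product on $R^n$ is $\langle g,h\rangle=\sum_{i=0}^{n-1}g_ih_i$, and $C^{\perp}=\{h\in R^n:\langle g,h\rangle=0\text{ for all }g\in C\}$. *)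

theory Defs
  imports "HOL-Algebra.UnivPoly" "HOL-Algebra.QuotRing"
begin

section \<open>Opposite rings, skew derivations and Ore extensions\<close>

definition opposite_ring :: "('a, 'm) ring_scheme \<Rightarrow> ('a, 'm) ring_scheme" where
  "opposite_ring R = R\<lparr>mult := (\<lambda>a b. b \<otimes>\<^bsub>R\<^esub> a)\<rparr>"

definition left_skew_derivation ::
    "('a, 'm) ring_scheme \<Rightarrow> ('a \<Rightarrow> 'a) \<Rightarrow> ('a \<Rightarrow> 'a) \<Rightarrow> bool" where
  "left_skew_derivation R \<sigma> \<delta> \<longleftrightarrow>
     \<delta> \<in> carrier R \<rightarrow> carrier R \<and>
     (\<forall>a\<in>carrier R. \<forall>b\<in>carrier R. \<delta> (a \<oplus>\<^bsub>R\<^esub> b) = \<delta> a \<oplus>\<^bsub>R\<^esub> \<delta> b) \<and>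
     (\<forall>a\<in>carrier R. \<forall>b\<in>carrier R.
        \<delta> (a \<otimes>\<^bsub>R\<^esub> b) = (\<sigma> a \<otimes>\<^bsub>R\<^esub> \<delta> b) \<oplus>\<^bsub>R\<^esub> (\<delta> a \<otimes>\<^bsub>R\<^esub> b))"

text \<open>Polynomials have their coefficients on the left. The commutation rule
  \<open>x a = \<sigma>(a) x + \<delta>(a)\<close> forces left multiplication by \<open>x\<close> to send
  \<open>\<Sum>\<^sub>k q\<^sub>k x\<^sup>k\<close> to \<open>\<Sum>\<^sub>k (\<sigma>(q\<^sub>k) x\<^sup>k\<^sup>+\<^sup>1 + \<delta>(q\<^sub>k) x\<^sup>k)\<close>, and
  \<open>(\<Sum>\<^sub>i p\<^sub>i x\<^sup>i) q = \<Sum>\<^sub>i p\<^sub>i (x\<^sup>i q)\<close>.\<close>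

definition ore_x_mult ::
    "('a, 'm) ring_scheme \<Rightarrow> ('a \<Rightarrow> 'a) \<Rightarrow> ('a \<Rightarrow> 'a) \<Rightarrow> (nat \<Rightarrow> 'a) \<Rightarrow> (nat \<Rightarrow> 'a)" where
  "ore_x_mult R \<sigma> \<delta> q =
     (\<lambda>k. (if k = 0 then \<zero>\<^bsub>R\<^esub> else \<sigma> (q (k - 1))) \<oplus>\<^bsub>R\<^esub> \<delta> (q k))"

definition ore_extension ::
    "('a, 'm) ring_scheme \<Rightarrow> ('a \<Rightarrow> 'a) \<Rightarrow> ('a \<Rightarrow> 'a) \<Rightarrow> ('a, nat \<Rightarrow> 'a) up_ring" where
  "ore_extension R \<sigma> \<delta> =
     (UP R)\<lparr>mult := (\<lambda>p\<in>up R. \<lambda>q\<in>up R. \<lambda>k.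
        \<Oplus>\<^bsub>R\<^esub>i\<in>{i. p i \<noteq> \<zero>\<^bsub>R\<^esub>}. p i \<otimes>\<^bsub>R\<^esub> ((ore_x_mult R \<sigma> \<delta> ^^ i) q) k)\<rparr>"

lemma (in ring) ring_endo_zero: assumes "h \<in> ring_hom R R" shows "h \<zero> = \<zero>"
  using assms ring_hom_zero ring_axioms by blast

lemma (in ring) left_skew_derivation_zero: assumes "left_skew_derivation R \<sigma> \<delta>" shows "\<delta> \<zero> = \<zero>"
proof -
  have c: "\<delta> \<zero> \<in> carrier R" using assms by (auto simp: left_skew_derivation_def)
  have "\<delta> (\<zero> \<oplus> \<zero>) = \<delta> \<zero> \<oplus> \<delta> \<zero>" using assms zero_closed unfolding left_skew_derivation_def by blast
  thus ?thesis using c by (metis add.r_cancel_one' l_zero zero_closed)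
qed

lemma (in ring) monom_mem_up: "a \<in> carrier R \<Longrightarrow> (\<lambda>i. if i = n then a else \<zero>) \<in> up R"
  by (intro mem_upI) auto

lemma (in ring) ore_extension_x_const:
  assumes s: "\<sigma> \<in> ring_hom R R" and d: "left_skew_derivation R \<sigma> \<delta>" and ne: "\<one> \<noteq> \<zero>" and a: "a \<in> carrier R"
  defines "S \<equiv> ore_extension R \<sigma> \<delta>"
  shows "monom S \<one> 1 \<otimes>\<^bsub>S\<^esub> monom S a 0 = (monom S (\<sigma> a) 1) \<oplus>\<^bsub>S\<^esub> monom S (\<delta> a) 0"
proof -
  have "{i. (if i = n then \<one> else \<zero>) \<noteq> \<zero>} = {n}" for n::nat using ne by auto
  moreover have sc: "\<And>a. a \<in> carrier R \<Longrightarrow> \<sigma> a \<in> carrier R" "\<And>a. a \<in> carrier R \<Longrightarrow> \<delta> a \<in> carrier R"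
    using s d by (auto simp: ring_hom_def left_skew_derivation_def)
  ultimately show ?thesis using a ring_endo_zero[OF s] left_skew_derivation_zero[OF d]
    by (auto simp: S_def ore_extension_def UP_def ore_x_mult_def monom_mem_up sc fun_eq_iff)
qed

lemma (in ring) ore_extension_x_power:
  assumes s: "\<sigma> \<in> ring_hom R R" and d: "left_skew_derivation R \<sigma> \<delta>" and ne: "\<one> \<noteq> \<zero>"
  defines "S \<equiv> ore_extension R \<sigma> \<delta>"
  shows "monom S \<one> r \<otimes>\<^bsub>S\<^esub> monom S \<one> t = monom S \<one> (r+t)"
proof -
  have e: "{i. (if i = n then \<one> else \<zero>) \<noteq> \<zero>} = {n}" for n::nat using ne by auto
  have s1: "\<sigma> \<one> = \<one>" using s by (auto simp: ring_hom_def)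
  have dc: "\<delta> \<one> \<in> carrier R" using d by (auto simp: left_skew_derivation_def)
  have "\<delta> (\<one> \<otimes> \<one>) = \<sigma> \<one> \<otimes> \<delta> \<one> \<oplus> \<delta> \<one> \<otimes> \<one>" using d one_closed unfolding left_skew_derivation_def by blast
  hence d1: "\<delta> \<one> = \<zero>" using s1 dc by (metis add.r_cancel_one' l_one r_one one_closed)
  have p: "(ore_x_mult R \<sigma> \<delta> ^^ m) (\<lambda>i. if i = t then \<one> else \<zero>) = (\<lambda>i. if i = m + t then \<one> else \<zero>)" for m
    by (induction m) (auto simp: ore_x_mult_def fun_eq_iff s1 d1 ring_endo_zero[OF s] left_skew_derivation_zero[OF d])
  show ?thesis by (auto simp: S_def ore_extension_def UP_def monom_mem_up e p fun_eq_iff)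
qed

definition monic_of_degree :: "('a, 'm) ring_scheme \<Rightarrow> nat \<Rightarrow> (nat \<Rightarrow> 'a) \<Rightarrow> bool" where
  "monic_of_degree R n f \<longleftrightarrow> deg R f = n \<and> coeff (UP R) f n = \<one>\<^bsub>R\<^esub>"

definition map_coeffs ::
    "('a, 'm) ring_scheme \<Rightarrow> ('a \<Rightarrow> 'a) \<Rightarrow> (nat \<Rightarrow> 'a) \<Rightarrow> (nat \<Rightarrow> 'a)" where
  "map_coeffs R \<tau> f = (\<lambda>i. \<tau> (coeff (UP R) f i))"

text \<open>The \<open>f\<^sub>i\<close> in \<open>f = - f\<^sub>0 - f\<^sub>1 x - \<dots> - f\<^sub>n\<^sub>-\<^sub>1 x\<^sup>n\<^sup>-\<^sup>1 + x\<^sup>n\<close>: note the sign.\<close>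

definition lower_coeff :: "('a, 'm) ring_scheme \<Rightarrow> (nat \<Rightarrow> 'a) \<Rightarrow> nat \<Rightarrow> 'a" where
  "lower_coeff R f i = \<ominus>\<^bsub>R\<^esub> coeff (UP R) f i"


section \<open>Vectors and matrices\<close>

text \<open>Vectors of length \<open>n\<close> are extensional functions on \<open>{..<n}\<close>. The multiplicative structure
  of the module record is not used.\<close>

definition free_module :: "('a, 'm) ring_scheme \<Rightarrow> nat \<Rightarrow> ('a, nat \<Rightarrow> 'a) module" where
  "free_module R n = \<lparr>
     carrier = {..<n} \<rightarrow>\<^sub>E carrier R,
     mult = undefined,
     one = undefined,
     zero = (\<lambda>i\<in>{..<n}. \<zero>\<^bsub>R\<^esub>),
     add = (\<lambda>v w. \<lambda>i\<in>{..<n}. v i \<oplus>\<^bsub>R\<^esub> w i),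
     smult = (\<lambda>a v. \<lambda>i\<in>{..<n}. a \<otimes>\<^bsub>R\<^esub> v i)\<rparr>"

definition map_vector :: "nat \<Rightarrow> ('a \<Rightarrow> 'a) \<Rightarrow> (nat \<Rightarrow> 'a) \<Rightarrow> (nat \<Rightarrow> 'a)" where
  "map_vector n \<tau> v = (\<lambda>i\<in>{..<n}. \<tau> (v i))"

text \<open>Matrices are functions of a row and a column index, both counted from \<open>0\<close>; only the entries
  with indices below \<open>n\<close> matter.\<close>

definition companion_matrix ::
    "('a, 'm) ring_scheme \<Rightarrow> nat \<Rightarrow> (nat \<Rightarrow> 'a) \<Rightarrow> nat \<Rightarrow> nat \<Rightarrow> 'a" where
  "companion_matrix R n f = (\<lambda>i j.
     if Suc i = n then lower_coeff R f j else if j = Suc i then \<one>\<^bsub>R\<^esub> else \<zero>\<^bsub>R\<^esub>)"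

definition matrix_transpose :: "(nat \<Rightarrow> nat \<Rightarrow> 'a) \<Rightarrow> nat \<Rightarrow> nat \<Rightarrow> 'a" where
  "matrix_transpose A = (\<lambda>i j. A j i)"

definition vector_matrix_mult ::
    "('a, 'm) ring_scheme \<Rightarrow> nat \<Rightarrow> (nat \<Rightarrow> 'a) \<Rightarrow> (nat \<Rightarrow> nat \<Rightarrow> 'a) \<Rightarrow> (nat \<Rightarrow> 'a)" where
  "vector_matrix_mult R n v A = (\<lambda>j\<in>{..<n}. \<Oplus>\<^bsub>R\<^esub>i\<in>{..<n}. v i \<otimes>\<^bsub>R\<^esub> A i j)"


section \<open>Codes\<close>

definition left_linear_code :: "('a, 'm) ring_scheme \<Rightarrow> nat \<Rightarrow> (nat \<Rightarrow> 'a) set \<Rightarrow> bool" where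
  "left_linear_code R n C \<longleftrightarrow> submodule C R (free_module R n)"

definition polycyclic_shift ::
    "('a, 'm) ring_scheme \<Rightarrow> ('a \<Rightarrow> 'a) \<Rightarrow> ('a \<Rightarrow> 'a) \<Rightarrow> nat \<Rightarrow> (nat \<Rightarrow> 'a)
      \<Rightarrow> (nat \<Rightarrow> 'a) \<Rightarrow> (nat \<Rightarrow> 'a)" where
  "polycyclic_shift R \<sigma> \<delta> n f g = (\<lambda>i\<in>{..<n}.
     (if i = 0 then \<zero>\<^bsub>R\<^esub> else \<sigma> (g (i - 1)))
       \<oplus>\<^bsub>R\<^esub> (\<sigma> (g (n - 1)) \<otimes>\<^bsub>R\<^esub> lower_coeff R f i) \<oplus>\<^bsub>R\<^esub> \<delta> (g i))"

definition right_polycyclic_code ::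
    "('a, 'm) ring_scheme \<Rightarrow> ('a \<Rightarrow> 'a) \<Rightarrow> ('a \<Rightarrow> 'a) \<Rightarrow> nat \<Rightarrow> (nat \<Rightarrow> 'a)
      \<Rightarrow> (nat \<Rightarrow> 'a) set \<Rightarrow> bool" where
  "right_polycyclic_code R \<sigma> \<delta> n f C \<longleftrightarrow>
     left_linear_code R n C \<and> (\<forall>g\<in>C. polycyclic_shift R \<sigma> \<delta> n f g \<in> C)"

definition sequential_shift ::
    "('a, 'm) ring_scheme \<Rightarrow> ('a \<Rightarrow> 'a) \<Rightarrow> ('a \<Rightarrow> 'a) \<Rightarrow> nat \<Rightarrow> (nat \<Rightarrow> 'a)
      \<Rightarrow> (nat \<Rightarrow> 'a) \<Rightarrow> (nat \<Rightarrow> 'a)" where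
  "sequential_shift R \<sigma> \<delta> n f g = (\<lambda>i\<in>{..<n}.
     (if Suc i < n then \<sigma> (g (Suc i))
      else (\<Oplus>\<^bsub>R\<^esub>j\<in>{..<n}. \<sigma> (g j) \<otimes>\<^bsub>R\<^esub> lower_coeff R f j)) \<oplus>\<^bsub>R\<^esub> \<delta> (g i))"

definition right_sequential_code ::
    "('a, 'm) ring_scheme \<Rightarrow> ('a \<Rightarrow> 'a) \<Rightarrow> ('a \<Rightarrow> 'a) \<Rightarrow> nat \<Rightarrow> (nat \<Rightarrow> 'a)
      \<Rightarrow> (nat \<Rightarrow> 'a) set \<Rightarrow> bool" where
  "right_sequential_code R \<sigma> \<delta> n f C \<longleftrightarrow>
     left_linear_code R n C \<and> (\<forall>g\<in>C. sequential_shift R \<sigma> \<delta> n f g \<in> C)"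

definition code_inner :: "('a, 'm) ring_scheme \<Rightarrow> nat \<Rightarrow> (nat \<Rightarrow> 'a) \<Rightarrow> (nat \<Rightarrow> 'a) \<Rightarrow> 'a" where
  "code_inner R n g h = (\<Oplus>\<^bsub>R\<^esub>i\<in>{..<n}. g i \<otimes>\<^bsub>R\<^esub> h i)"

definition dual_code :: "('a, 'm) ring_scheme \<Rightarrow> nat \<Rightarrow> (nat \<Rightarrow> 'a) set \<Rightarrow> (nat \<Rightarrow> 'a) set" where
  "dual_code R n C =
     {h \<in> carrier (free_module R n). \<forall>g\<in>C. code_inner R n g h = \<zero>\<^bsub>R\<^esub>}"

end

theory Submission
  imports Defs
begin

text \<open>
  Write \<open>T\<close> for the polycyclic shift attached to \<open>(\<sigma>, \<delta>, f)\<close> and \<open>T'\<close> for the sequential shift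
  attached to \<open>(\<sigma>', \<delta>', f')\<close>. The two are adjoint up to a twist:
  \<open>\<langle>T g, v\<rangle> = \<sigma> \<langle>g, T' v\<rangle> + \<delta> \<langle>g, v\<rangle>\<close>.
  If \<open>v\<close> is orthogonal to \<open>g\<close> and to \<open>T g\<close>, this reads \<open>\<sigma> \<langle>g, T' v\<rangle> = 0\<close>, and \<open>\<sigma>\<close> is injective.
\<close>

section \<open>The opposite ring\<close>

lemma opposite_ring_simps [simp]:
  "carrier (opposite_ring R) = carrier R"
  "zero (opposite_ring R) = zero R"
  "one (opposite_ring R) = one R"
  "add (opposite_ring R) = add R"
  "mult (opposite_ring R) a b = mult R b a"
  by (simp_all add: opposite_ring_def)

lemma finsum_opposite_ring [simp]: "finsum (opposite_ring R) = finsum R"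
  by (simp add: finsum_def fun_eq_iff)

lemma a_inv_opposite_ring [simp]: "a_inv (opposite_ring R) = a_inv R"
  by (simp add: a_inv_def)

lemma up_opposite_ring [simp]: "up (opposite_ring R) = up R"
  by (simp add: up_def)

lemma coeff_opposite_ring [simp]: "coeff (UP (opposite_ring R)) = coeff (UP R)"
  by (simp add: UP_def)

lemma lower_coeff_opposite_ring [simp]: "lower_coeff (opposite_ring R) = lower_coeff R"
  by (simp add: lower_coeff_def fun_eq_iff)

lemma monic_of_degree_opposite_ring [simp]:
  "monic_of_degree (opposite_ring R) n f \<longleftrightarrow> monic_of_degree R n f"
  by (simp add: monic_of_degree_def deg_def)

lemma carrier_ore_extension: "carrier (ore_extension R \<sigma> \<delta>) = up R"
  by (simp add: ore_extension_def UP_def)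

lemma (in ring) ring_opposite_ring: "ring (opposite_ring R)"
proof (rule ringI)
  show "abelian_group (opposite_ring R)"
    by (rule abelian_groupI) (auto simp: a_ac intro: add.l_inv_ex)
  show "Group.monoid (opposite_ring R)"
    by (rule monoidI) (auto simp: m_assoc)
qed (auto simp: l_distr r_distr)

lemma (in cring) cring_opposite_ring: "cring (opposite_ring R)"
  by (intro cring.intro ring_opposite_ring comm_monoid.intro comm_monoid_axioms.intro
      ring.is_monoid) (auto simp: m_comm)

text \<open>Multiplicativity of the identity into the opposite ring reads
  \<open>a \<otimes> b = b \<otimes> a\<close>; this turns the anti-automorphism hypothesis into
  commutativity.\<close>

lemma (in ring) cring_if_id_iso_opposite:
  assumes "id \<in> ring_iso R (opposite_ring R)"
  shows "cring R"
proof (intro cring.intro ring_axioms comm_monoid.intro comm_monoid_axioms.intro is_monoid)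
  show "a \<otimes> b = b \<otimes> a" if "a \<in> carrier R" "b \<in> carrier R" for a b
    using ring_iso_memE(2)[OF assms that] by simp
qed

lemma ring_hom_opposite_ring:
  assumes "h \<in> ring_hom R S"
  shows "h \<in> ring_hom (opposite_ring R) (opposite_ring S)"
  using assms by (auto simp: ring_hom_def)


section \<open>Additive maps and inverses of skew derivations\<close>

text \<open>Stated for additive maps because it has to cover a skew derivation, which is not
  multiplicative. The value at \<open>\<zero>\<close> settles the empty and the infinite index sets,
  where the sum is \<open>\<zero>\<close>.\<close>

lemma (in abelian_group) additive_finsum:
  assumes "h \<in> carrier G \<rightarrow> carrier G" "h \<zero> = \<zero>"
    and "\<And>a b. a \<in> carrier G \<Longrightarrow> b \<in> carrier G \<Longrightarrow> h (a \<oplus> b) = h a \<oplus> h b"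
    and "u \<in> A \<rightarrow> carrier G"
  shows "h (\<Oplus>i\<in>A. u i) = (\<Oplus>i\<in>A. h (u i))"
  using assms(4)
proof (induction A rule: infinite_finite_induct)
  case (insert i A)
  then show ?case
    using assms(1-3) by (simp add: Pi_iff)
qed (use assms in auto)

text \<open>Applying \<open>\<sigma>'\<close> to the Leibniz rule for \<open>\<delta>\<close>
  removes the twist from the left factor and puts \<open>\<sigma>'\<close> on the right one.
  Reversing the factors brings the twisted one back to the left, which is why the opposite ring is
  the right home for the new derivation.\<close>

lemma (in ring) left_skew_derivation_inverse:
  assumes iso: "\<sigma> \<in> ring_iso R R" and d: "left_skew_derivation R \<sigma> \<delta>"
  defines "\<sigma>' \<equiv> inv_into (carrier R) \<sigma>"
  shows "left_skew_derivation (opposite_ring R) \<sigma>' (\<lambda>a. \<ominus> \<sigma>' (\<delta> a))"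
proof -
  have hom: "\<sigma>' \<in> ring_hom R R"
    using ring_iso_set_sym[OF ring_axioms iso] by (simp add: \<sigma>'_def ring_iso_def)
  have inv: "\<sigma>' (\<sigma> a) = a" if "a \<in> carrier R" for a
    using iso that by (simp add: \<sigma>'_def ring_iso_def bij_betw_def)
  have s: "\<sigma> a \<in> carrier R" if "a \<in> carrier R" for a
    using iso that by (simp add: ring_iso_memE)
  note s' = ring_hom_memE[OF hom]
  have dc: "\<delta> a \<in> carrier R" if "a \<in> carrier R" for a
    using d that by (auto simp: left_skew_derivation_def)
  have da: "\<delta> (a \<oplus> b) = \<delta> a \<oplus> \<delta> b" and dm: "\<delta> (a \<otimes> b) = \<sigma> a \<otimes> \<delta> b \<oplus> \<delta> a \<otimes> b"
    if "a \<in> carrier R" "b \<in> carrier R" for a b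
    using d that by (auto simp: left_skew_derivation_def)
  \<comment> \<open>This is the Leibniz rule for the product of \<open>a\<close> and
    \<open>b\<close>, in this order, in the opposite ring.\<close>
  have "\<ominus> \<sigma>' (\<delta> (b \<otimes> a)) = (\<ominus> \<sigma>' (\<delta> b)) \<otimes> \<sigma>' a \<oplus> b \<otimes> (\<ominus> \<sigma>' (\<delta> a))"
    if "a \<in> carrier R" "b \<in> carrier R" for a b
  proof -
    have "\<ominus> \<sigma>' (\<delta> (b \<otimes> a)) = \<ominus> (b \<otimes> \<sigma>' (\<delta> a) \<oplus> \<sigma>' (\<delta> b) \<otimes> \<sigma>' a)"
      using that by (simp add: dm s dc s' inv)
    also have "\<dots> = (\<ominus> \<sigma>' (\<delta> b)) \<otimes> \<sigma>' a \<oplus> b \<otimes> (\<ominus> \<sigma>' (\<delta> a))"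
      using that by (simp add: dc s'(1) minus_add l_minus r_minus a_comm)
    finally show ?thesis .
  qed
  then show ?thesis
    unfolding left_skew_derivation_def by (simp add: da s' dc minus_add a_comm)
qed


section \<open>Coefficientwise images of polynomials\<close>

text \<open>The coefficient map of \<open>UP R\<close> is restricted to \<open>up R\<close>, so
  membership of \<open>f\<close> is what turns \<open>map_coeffs\<close> into composition. Finite
  support survives because \<open>\<tau>\<close> fixes \<open>\<zero>\<close>.\<close>

lemma (in ring) map_coeffs_up:
  assumes "\<tau> \<in> ring_hom R R" "f \<in> up R"
  shows "map_coeffs R \<tau> f = \<tau> \<circ> f" "\<tau> \<circ> f \<in> up R"
proof -
  show "map_coeffs R \<tau> f = \<tau> \<circ> f"
    using assms(2) by (auto simp: map_coeffs_def UP_def)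
  obtain n where "bound \<zero> n f"
    using assms(2) by (auto simp: up_def)
  then have "bound \<zero> n (\<tau> \<circ> f)"
    using ring_endo_zero[OF assms(1)] by (auto simp: bound_def)
  then show "\<tau> \<circ> f \<in> up R"
    using assms by (auto simp: up_def ring_hom_closed Pi_iff)
qed

text \<open>An injective homomorphism sends only \<open>\<zero>\<close> to \<open>\<zero>\<close>,
  so \<open>f\<close> and its image have the same degree bounds, hence the same least one.\<close>

lemma (in ring) monic_of_degree_map_coeffs:
  assumes "\<tau> \<in> ring_iso R R" "f \<in> up R" "monic_of_degree R n f"
  shows "monic_of_degree R n (map_coeffs R \<tau> f)"
proof -
  have hom: "\<tau> \<in> ring_hom R R" and inj: "inj_on \<tau> (carrier R)"
    using assms(1) by (auto simp: ring_iso_def bij_betw_def)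
  have "\<tau> (f i) = \<zero> \<longleftrightarrow> f i = \<zero>" for i
    using inj_onD[OF inj, of "f i" \<zero>] ring_endo_zero[OF hom] assms(2)
    by (auto simp: up_def)
  then have "bound \<zero> m (\<tau> \<circ> f) \<longleftrightarrow> bound \<zero> m f" for m
    by (simp add: bound_def)
  then show ?thesis
    using assms(2,3) map_coeffs_up[OF hom assms(2)] ring_hom_one[OF hom]
    by (simp add: monic_of_degree_def deg_def UP_def)
qed

lemma (in ring) lower_coeff_closed:
  assumes "f \<in> up R"
  shows "lower_coeff R f i \<in> carrier R"
  using assms by (auto simp: lower_coeff_def UP_def up_def)

lemma (in cring) lower_coeff_map_coeffs:
  assumes "\<tau> \<in> ring_hom R R" "f \<in> up R"
  shows "lower_coeff R (map_coeffs R \<tau> f) i = \<tau> (lower_coeff R f i)"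
proof -
  interpret h: ring_hom_cring R R \<tau>
    by (intro ring_hom_cring.intro ring_hom_cring_axioms.intro is_cring assms(1))
  show ?thesis
    using assms(2) map_coeffs_up[OF assms] by (auto simp: lower_coeff_def UP_def up_def Pi_iff)
qed


section \<open>Free modules and dual codes\<close>

lemma free_module_simps [simp]:
  "carrier (free_module R n) = {..<n} \<rightarrow>\<^sub>E carrier R"
  "zero (free_module R n) = (\<lambda>i\<in>{..<n}. \<zero>\<^bsub>R\<^esub>)"
  "add (free_module R n) v w = (\<lambda>i\<in>{..<n}. v i \<oplus>\<^bsub>R\<^esub> w i)"
  "smult (free_module R n) a v = (\<lambda>i\<in>{..<n}. a \<otimes>\<^bsub>R\<^esub> v i)"
  by (simp_all add: free_module_def)

text \<open>The unit laws hold as equations of functions because vectors are extensional: outside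
  \<open>{..<n}\<close> both sides are \<open>undefined\<close>.\<close>

lemma (in cring) free_module_module: "module R (free_module R n)"
proof (rule moduleI)
  show "cring R"
    by (rule is_cring)
  show "abelian_group (free_module R n)"
  proof (rule abelian_groupI)
    fix v assume v: "v \<in> carrier (free_module R n)"
    then have "(\<lambda>i\<in>{..<n}. \<ominus> v i) \<in> carrier (free_module R n)"
      and "(\<lambda>i\<in>{..<n}. \<ominus> v i) \<oplus>\<^bsub>free_module R n\<^esub> v = \<zero>\<^bsub>free_module R n\<^esub>"
      by (auto simp: l_neg PiE_iff)
    then show "\<exists>w\<in>carrier (free_module R n). w \<oplus>\<^bsub>free_module R n\<^esub> v = \<zero>\<^bsub>free_module R n\<^esub>"
      by blast
    show "\<zero>\<^bsub>free_module R n\<^esub> \<oplus>\<^bsub>free_module R n\<^esub> v = v"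
      using v by (auto simp: PiE_iff extensional_def fun_eq_iff)
  qed (auto simp: PiE_iff a_ac fun_eq_iff)
  fix v assume "v \<in> carrier (free_module R n)"
  then show "\<one> \<odot>\<^bsub>free_module R n\<^esub> v = v"
    by (auto simp: PiE_iff extensional_def fun_eq_iff)
qed (auto simp: PiE_iff l_distr r_distr m_assoc fun_eq_iff)

lemma left_linear_code_subset:
  assumes "left_linear_code R n C"
  shows "C \<subseteq> {..<n} \<rightarrow>\<^sub>E carrier R"
  using subgroup.subset[OF submodule.axioms(1)[OF assms[unfolded left_linear_code_def]]] by simp

context cring
begin

text \<open>Closure under negation is derived, as multiplication by
  \<open>\<ominus> \<one>\<close>.\<close>

lemma left_linear_codeI:
  assumes sub: "C \<subseteq> {..<n} \<rightarrow>\<^sub>E carrier R"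
    and zero: "(\<lambda>i\<in>{..<n}. \<zero>) \<in> C"
    and add: "\<And>v w. v \<in> C \<Longrightarrow> w \<in> C \<Longrightarrow> (\<lambda>i\<in>{..<n}. v i \<oplus> w i) \<in> C"
    and smult: "\<And>a v. a \<in> carrier R \<Longrightarrow> v \<in> C \<Longrightarrow> (\<lambda>i\<in>{..<n}. a \<otimes> v i) \<in> C"
  shows "left_linear_code R n C"
proof -
  interpret M: module R "free_module R n"
    by (rule free_module_module)
  have "\<ominus>\<^bsub>free_module R n\<^esub> v \<in> C" if "v \<in> C" for v
  proof -
    have "v \<in> carrier (free_module R n)"
      using that sub by auto
    then have "\<ominus>\<^bsub>free_module R n\<^esub> v = (\<ominus> \<one>) \<odot>\<^bsub>free_module R n\<^esub> v"
      using M.smult_l_minus[of \<one> v] M.smult_one[of v] by simp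
    then show ?thesis
      using smult[of "\<ominus> \<one>" v] that by simp
  qed
  then show ?thesis
    unfolding left_linear_code_def using assms by (intro M.submoduleI) auto
qed

text \<open>The inner product is linear in its second argument. Here \<open>C\<close> is an
  arbitrary set of vectors, so the lemma can be applied over the opposite ring without first showing
  that \<open>C\<close> is linear there.\<close>

lemma left_linear_code_dual_code:
  assumes C: "C \<subseteq> {..<n} \<rightarrow>\<^sub>E carrier R"
  shows "left_linear_code R n (dual_code R n C)"
proof (rule left_linear_codeI)
  have g: "g i \<in> carrier R" if "g \<in> C" "i < n" for g i
    using that C by (auto simp: PiE_iff)
  show "dual_code R n C \<subseteq> {..<n} \<rightarrow>\<^sub>E carrier R"
    by (auto simp: dual_code_def)
  have "code_inner R n g (\<lambda>i\<in>{..<n}. \<zero>) = \<zero>" if "g \<in> C" for g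
  proof -
    have "code_inner R n g (\<lambda>i\<in>{..<n}. \<zero>) = (\<Oplus>i\<in>{..<n}. \<zero>)"
      unfolding code_inner_def by (rule finsum_cong') (use g that in auto)
    then show ?thesis
      by simp
  qed
  then show "(\<lambda>i\<in>{..<n}. \<zero>) \<in> dual_code R n C"
    by (auto simp: dual_code_def)
next
  have g: "g i \<in> carrier R" if "g \<in> C" "i < n" for g i
    using that C by (auto simp: PiE_iff)
  fix v w assume vw: "v \<in> dual_code R n C" "w \<in> dual_code R n C"
  then have c: "v i \<in> carrier R" "w i \<in> carrier R" if "i < n" for i
    using that by (auto simp: dual_code_def PiE_iff)
  have "code_inner R n g (\<lambda>i\<in>{..<n}. v i \<oplus> w i) = \<zero>" if "g \<in> C" for g
  proof -
    have "code_inner R n g (\<lambda>i\<in>{..<n}. v i \<oplus> w i) = (\<Oplus>i\<in>{..<n}. g i \<otimes> v i \<oplus> g i \<otimes> w i)"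
      unfolding code_inner_def by (rule finsum_cong') (use g[OF that] c in \<open>auto simp: r_distr\<close>)
    also have "\<dots> = code_inner R n g v \<oplus> code_inner R n g w"
      unfolding code_inner_def by (rule finsum_addf) (use g[OF that] c in auto)
    finally show ?thesis
      using vw that by (simp add: dual_code_def)
  qed
  then show "(\<lambda>i\<in>{..<n}. v i \<oplus> w i) \<in> dual_code R n C"
    using c by (auto simp: dual_code_def)
next
  have g: "g i \<in> carrier R" if "g \<in> C" "i < n" for g i
    using that C by (auto simp: PiE_iff)
  fix a v assume a: "a \<in> carrier R" and v: "v \<in> dual_code R n C"
  then have c: "v i \<in> carrier R" if "i < n" for i
    using that by (auto simp: dual_code_def PiE_iff)
  have "code_inner R n g (\<lambda>i\<in>{..<n}. a \<otimes> v i) = \<zero>" if "g \<in> C" for g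
  proof -
    \<comment> \<open>Commutativity moves the scalar past \<open>g i\<close>.\<close>
    have "code_inner R n g (\<lambda>i\<in>{..<n}. a \<otimes> v i) = (\<Oplus>i\<in>{..<n}. a \<otimes> (g i \<otimes> v i))"
      unfolding code_inner_def by (rule finsum_cong') (use g[OF that] c a in \<open>auto simp: m_lcomm\<close>)
    also have "\<dots> = a \<otimes> code_inner R n g v"
      unfolding code_inner_def
      by (rule finsum_rdistr[symmetric]) (use g[OF that] c a in auto)
    finally show ?thesis
      using v a that by (simp add: dual_code_def)
  qed
  then show "(\<lambda>i\<in>{..<n}. a \<otimes> v i) \<in> dual_code R n C"
    using c a by (auto simp: dual_code_def)
qed

text \<open>Commutativity makes the two inner products agree, so a statement about the dual formed
  over the opposite ring can be read for the dual formed over \<open>R\<close>.\<close>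

lemma dual_code_opposite_ring:
  assumes C: "C \<subseteq> {..<n} \<rightarrow>\<^sub>E carrier R"
  shows "dual_code (opposite_ring R) n C = dual_code R n C"
proof -
  have "code_inner (opposite_ring R) n g h = code_inner R n g h"
    if "g \<in> C" "h \<in> {..<n} \<rightarrow>\<^sub>E carrier R" for g h
  proof -
    have "g \<in> {..<n} \<rightarrow>\<^sub>E carrier R"
      using that C by auto
    then show ?thesis
      using that(2) unfolding code_inner_def finsum_opposite_ring opposite_ring_simps
      by (intro finsum_cong') (auto simp: PiE_iff m_comm)
  qed
  then show ?thesis
    by (auto simp: dual_code_def)
qed

end


section \<open>Adjointness of the two shifts\<close>

context cring
begin

section \<open>The sequential shift: closure, order of multiplication, matrix form\<close>

lemma sequential_shift_closed:
  assumes "\<sigma> \<in> carrier R \<rightarrow> carrier R" "\<delta> \<in> carrier R \<rightarrow> carrier R" "f \<in> up R"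
    and "v \<in> {..<n} \<rightarrow>\<^sub>E carrier R"
  shows "sequential_shift R \<sigma> \<delta> n f v \<in> {..<n} \<rightarrow>\<^sub>E carrier R"
proof -
  have "(\<Oplus>j\<in>{..<n}. \<sigma> (v j) \<otimes> lower_coeff R f j) \<in> carrier R"
    by (rule finsum_closed) (use assms lower_coeff_closed in \<open>auto simp: PiE_iff Pi_iff\<close>)
  then show ?thesis
    using assms by (auto simp: sequential_shift_def PiE_iff Pi_iff)
qed

text \<open>The multiplication enters only in the last entry, a sum of products whose factors
  commute.\<close>

lemma sequential_shift_opposite_ring:
  assumes "\<sigma> \<in> carrier R \<rightarrow> carrier R" "f \<in> up R" "v \<in> {..<n} \<rightarrow>\<^sub>E carrier R"
  shows "sequential_shift (opposite_ring R) \<sigma> \<delta> n f v = sequential_shift R \<sigma> \<delta> n f v"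
proof -
  have "(\<Oplus>j\<in>{..<n}. lower_coeff R f j \<otimes> \<sigma> (v j)) = (\<Oplus>j\<in>{..<n}. \<sigma> (v j) \<otimes> lower_coeff R f j)"
    by (rule finsum_cong') (use assms lower_coeff_closed in \<open>auto simp: PiE_iff Pi_iff m_comm\<close>)
  then show ?thesis
    by (simp add: sequential_shift_def cong: if_cong)
qed

text \<open>The transpose makes entry \<open>j\<close> the pairing of the vector with row
  \<open>j\<close> of the companion matrix. A basis row picks out the next entry; the last row gives
  the combination with the coefficients of \<open>f\<close>.\<close>

lemma sequential_shift_eq_companion_matrix:
  assumes s: "\<sigma> \<in> carrier R \<rightarrow> carrier R" and f: "f \<in> up R" and v: "v \<in> {..<n} \<rightarrow>\<^sub>E carrier R"
  shows "vector_matrix_mult R n (map_vector n \<sigma> v) (matrix_transpose (companion_matrix R n f))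
           \<oplus>\<^bsub>free_module R n\<^esub> map_vector n \<delta> v = sequential_shift R \<sigma> \<delta> n f v"
proof -
  have c: "\<sigma> (v i) \<in> carrier R" if "i < n" for i
    using s v that by (auto simp: PiE_iff)
  have "(\<Oplus>i\<in>{..<n}. map_vector n \<sigma> v i \<otimes> companion_matrix R n f j i)
      = (if Suc j < n then \<sigma> (v (Suc j)) else (\<Oplus>i\<in>{..<n}. \<sigma> (v i) \<otimes> lower_coeff R f i))"
    if "j < n" for j
  proof (cases "Suc j < n")
    case True
    have "(\<Oplus>i\<in>{..<n}. map_vector n \<sigma> v i \<otimes> companion_matrix R n f j i)
        = (\<Oplus>i\<in>{..<n}. if Suc j = i then \<sigma> (v i) else \<zero>)"
      by (rule finsum_cong') (use True c in \<open>auto simp: map_vector_def companion_matrix_def\<close>)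
    also have "\<dots> = \<sigma> (v (Suc j))"
      by (rule finsum_singleton) (use True c in auto)
    finally show ?thesis
      using True by simp
  next
    case False
    then have "Suc j = n"
      using that by simp
    then show ?thesis
      using c lower_coeff_closed[OF f]
      by (auto simp: map_vector_def companion_matrix_def simp_implies_def intro!: add.finprod_cong)
  qed
  then show ?thesis
    by (auto simp: vector_matrix_mult_def sequential_shift_def matrix_transpose_def map_vector_def
        fun_eq_iff)
qed

text \<open>Moving the shift from \<open>g\<close> to \<open>v\<close> is a change of index, and the
  \<open>f\<close> part supplies the top term that it lacks. In the sequential shift
  \<open>\<sigma>\<close> cancels \<open>\<sigma>'\<close>, and the derivation parts match by the
  Leibniz rule for \<open>\<delta>\<close>.\<close>

lemma code_inner_polycyclic_shift:
  assumes iso: "\<sigma> \<in> ring_iso R R" and d: "left_skew_derivation R \<sigma> \<delta>" and f: "f \<in> up R"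
    and g: "g \<in> {..<n} \<rightarrow>\<^sub>E carrier R" and v: "v \<in> {..<n} \<rightarrow>\<^sub>E carrier R"
  defines "\<sigma>' \<equiv> inv_into (carrier R) \<sigma>"
  shows "code_inner R n (polycyclic_shift R \<sigma> \<delta> n f g) v
    = \<sigma> (code_inner R n g
          (sequential_shift R \<sigma>' (\<lambda>a. \<ominus> \<sigma>' (\<delta> a)) n (map_coeffs R \<sigma>' f) v))
      \<oplus> \<delta> (code_inner R n g v)"
proof -
  have hom: "\<sigma> \<in> ring_hom R R"
    using iso by (simp add: ring_iso_def)
  have hom': "\<sigma>' \<in> ring_hom R R"
    using ring_iso_set_sym[OF ring_axioms iso] by (simp add: \<sigma>'_def ring_iso_def)
  interpret s: ring_hom_cring R R \<sigma>
    by (intro ring_hom_cring.intro ring_hom_cring_axioms.intro is_cring hom)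
  interpret s': ring_hom_cring R R \<sigma>'
    by (intro ring_hom_cring.intro ring_hom_cring_axioms.intro is_cring hom')
  have inv: "\<sigma> (\<sigma>' a) = a" if "a \<in> carrier R" for a
    using iso that by (simp add: \<sigma>'_def ring_iso_def bij_betw_def f_inv_into_f)
  have dc: "\<delta> a \<in> carrier R" if "a \<in> carrier R" for a
    using d that by (auto simp: left_skew_derivation_def)
  have da: "\<delta> (a \<oplus> b) = \<delta> a \<oplus> \<delta> b" and dm: "\<delta> (a \<otimes> b) = \<sigma> a \<otimes> \<delta> b \<oplus> \<delta> a \<otimes> b"
    if "a \<in> carrier R" "b \<in> carrier R" for a b
    using d that by (auto simp: left_skew_derivation_def)
  have gc: "g i \<in> carrier R" and vc: "v i \<in> carrier R" if "i < n" for i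
    using g v that by (auto simp: PiE_iff)
  define l where "l = lower_coeff R f"
  have lc: "l i \<in> carrier R" for i
    using lower_coeff_closed[OF f] by (simp add: l_def)
  have lower: "lower_coeff R (map_coeffs R \<sigma>' f) i = \<sigma>' (l i)" for i
    using lower_coeff_map_coeffs[OF hom' f] by (simp add: l_def)
  \<comment> \<open>Apart from its derivation part, the last entry of the sequential shift becomes
    \<open>L\<close> under \<open>\<sigma>\<close>.\<close>
  define L where "L = (\<Oplus>j\<in>{..<n}. l j \<otimes> v j)"
  have Lc: "L \<in> carrier R"
    unfolding L_def by (rule finsum_closed) (use vc lc in auto)
  \<comment> \<open>\<open>A\<close> is the twisted right shift of \<open>g\<close>, with
    \<open>\<zero>\<close> in front; \<open>B\<close> is the left shift of \<open>v\<close>, with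
    \<open>L\<close> in the vacated last place.\<close>
  define A where "A i = (if i = 0 then \<zero> else \<sigma> (g (i - 1)))" for i
  define B where "B i = (if Suc i < n then v (Suc i) else L)" for i
  have Ac: "A i \<in> carrier R" and Bc: "B i \<in> carrier R" if "i < n" for i
    using that gc vc Lc by (auto simp: A_def B_def)
  define T where "T = sequential_shift R \<sigma>' (\<lambda>a. \<ominus> \<sigma>' (\<delta> a)) n (map_coeffs R \<sigma>' f) v"
  have Tc: "T i \<in> carrier R" if "i < n" for i
    using sequential_shift_closed[of \<sigma>' "\<lambda>a. \<ominus> \<sigma>' (\<delta> a)" "map_coeffs R \<sigma>' f" v n]
      map_coeffs_up[OF hom' f] v dc that by (auto simp: T_def PiE_iff)
  \<comment> \<open>\<open>\<sigma>\<close> undoes \<open>\<sigma>'\<close> in every entry, so the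
    derivation part \<open>\<ominus> \<sigma>' (\<delta> (v i))\<close> becomes
    \<open>\<ominus> \<delta> (v i)\<close>.\<close>
  have \<sigma>T: "\<sigma> (T i) = B i \<oplus> \<ominus> \<delta> (v i)" if "i < n" for i
  proof -
    have "\<sigma> (\<Oplus>j\<in>{..<n}. \<sigma>' (v j) \<otimes> \<sigma>' (l j)) = (\<Oplus>j\<in>{..<n}. (\<sigma> \<circ> (\<lambda>j. \<sigma>' (v j) \<otimes> \<sigma>' (l j))) j)"
      by (rule s.hom_finsum) (use vc lc in auto)
    also have "\<dots> = L"
      unfolding L_def by (rule finsum_cong') (use vc lc in \<open>auto simp: inv m_comm\<close>)
    finally have "\<sigma> (\<Oplus>j\<in>{..<n}. \<sigma>' (v j) \<otimes> \<sigma>' (l j)) = L" .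
    moreover have "(\<Oplus>j\<in>{..<n}. \<sigma>' (v j) \<otimes> \<sigma>' (l j)) \<in> carrier R"
      by (rule finsum_closed) (use vc lc in auto)
    ultimately show ?thesis
      using that vc dc by (simp add: T_def sequential_shift_def lower B_def inv)
  qed
  \<comment> \<open>After a change of index the first sum gives the terms on the right below the
    last index; the second sum, \<open>\<sigma> (g (n - 1)) \<otimes> L\<close>, is the last
    term.\<close>
  have shift: "(\<Oplus>i\<in>{..<n}. A i \<otimes> v i) \<oplus> (\<Oplus>i\<in>{..<n}. \<sigma> (g (n - 1)) \<otimes> l i \<otimes> v i)
      = (\<Oplus>i\<in>{..<n}. \<sigma> (g i) \<otimes> B i)"
  \<comment> \<open>For \<open>n = 0\<close> all sums are empty, so the truncated
    \<open>n - 1\<close> does no harm.\<close>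
  proof (cases n)
    case (Suc m)
    \<comment> \<open>The term at \<open>0\<close> vanishes by the choice of \<open>A\<close>. The
      case \<open>m = 0\<close> is separate because nothing then remains to be reindexed.\<close>
    have 1: "(\<Oplus>i\<in>{..<Suc m}. A i \<otimes> v i) = (\<Oplus>i\<in>{..<m}. \<sigma> (g i) \<otimes> v (Suc i))"
    proof (cases m)
      case 0
      then show ?thesis
        using vc Suc by (simp add: A_def lessThan_Suc)
    next
      case (Suc k)
      then have "(\<Oplus>i\<in>{..<Suc m}. A i \<otimes> v i) = (\<Oplus>i\<in>{..k}. A (Suc i) \<otimes> v (Suc i)) \<oplus> A 0 \<otimes> v 0"
        using finsum_Suc2[of "\<lambda>i. A i \<otimes> v i" k] Ac vc \<open>n = Suc m\<close>
        by (simp add: lessThan_Suc_atMost Pi_iff)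
      moreover have "(\<Oplus>i\<in>{..k}. \<sigma> (g i) \<otimes> v (Suc i)) \<in> carrier R"
        by (rule finsum_closed) (use gc vc \<open>n = Suc m\<close> Suc in auto)
      ultimately show ?thesis
        using vc \<open>n = Suc m\<close> Suc by (simp add: A_def lessThan_Suc_atMost)
    qed
    have 2: "(\<Oplus>i\<in>{..<n}. \<sigma> (g (n - 1)) \<otimes> l i \<otimes> v i) = \<sigma> (g m) \<otimes> L"
    proof -
      have "\<sigma> (g m) \<otimes> L = (\<Oplus>i\<in>{..<n}. \<sigma> (g m) \<otimes> (l i \<otimes> v i))"
        unfolding L_def by (rule finsum_rdistr) (use gc vc lc Suc in auto)
      also have "\<dots> = (\<Oplus>i\<in>{..<n}. \<sigma> (g (n - 1)) \<otimes> l i \<otimes> v i)"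
        by (rule finsum_cong') (use gc vc lc Suc in \<open>auto simp: m_assoc\<close>)
      finally show ?thesis ..
    qed
    \<comment> \<open>The last index is split off because \<open>B m = L\<close>, while
      \<open>B i = v (Suc i)\<close> below it.\<close>
    have "(\<Oplus>i\<in>{..<n}. \<sigma> (g i) \<otimes> B i) = \<sigma> (g m) \<otimes> B m \<oplus> (\<Oplus>i\<in>{..<m}. \<sigma> (g i) \<otimes> B i)"
      unfolding Suc lessThan_Suc by (rule finsum_insert) (use gc Bc Suc in auto)
    also have "(\<Oplus>i\<in>{..<m}. \<sigma> (g i) \<otimes> B i) = (\<Oplus>i\<in>{..<m}. \<sigma> (g i) \<otimes> v (Suc i))"
      by (rule finsum_cong') (use gc vc Suc in \<open>auto simp: B_def\<close>)
    finally have 3: "(\<Oplus>i\<in>{..<n}. \<sigma> (g i) \<otimes> B i)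
        = \<sigma> (g m) \<otimes> L \<oplus> (\<Oplus>i\<in>{..<m}. \<sigma> (g i) \<otimes> v (Suc i))"
      by (simp add: B_def Suc)
    have "(\<Oplus>i\<in>{..<m}. \<sigma> (g i) \<otimes> v (Suc i)) \<in> carrier R"
      by (rule finsum_closed) (use gc vc Suc in auto)
    then show ?thesis
      using 1 2 3 Suc gc Lc by (simp add: a_comm)
  qed simp
  have "code_inner R n (polycyclic_shift R \<sigma> \<delta> n f g) v
      = (\<Oplus>i\<in>{..<n}. A i \<otimes> v i \<oplus> \<sigma> (g (n - 1)) \<otimes> l i \<otimes> v i \<oplus> \<delta> (g i) \<otimes> v i)"
    unfolding code_inner_def
    by (rule finsum_cong')
      (use gc vc lc dc Ac in \<open>auto simp: polycyclic_shift_def A_def l_def[symmetric] l_distr\<close>)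
  also have "\<dots> = (\<Oplus>i\<in>{..<n}. A i \<otimes> v i) \<oplus> (\<Oplus>i\<in>{..<n}. \<sigma> (g (n - 1)) \<otimes> l i \<otimes> v i)
      \<oplus> (\<Oplus>i\<in>{..<n}. \<delta> (g i) \<otimes> v i)"
    using gc vc lc dc Ac by (simp add: finsum_addf Pi_iff)
  also have "\<dots> = (\<Oplus>i\<in>{..<n}. \<sigma> (g i) \<otimes> B i) \<oplus> (\<Oplus>i\<in>{..<n}. \<delta> (g i) \<otimes> v i)"
    by (simp only: shift)
  also have "\<dots> = (\<Oplus>i\<in>{..<n}. \<sigma> (g i) \<otimes> B i \<oplus> \<delta> (g i) \<otimes> v i)"
    by (rule finsum_addf[symmetric]) (use gc vc dc Bc in auto)
  \<comment> \<open>The Leibniz rule writes \<open>\<delta> (g i) \<otimes> v i\<close> as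
    \<open>\<delta> (g i \<otimes> v i)\<close> minus
    \<open>\<sigma> (g i) \<otimes> \<delta> (v i)\<close>. The subtracted term comes from the
    summand \<open>\<ominus> \<delta> (v i)\<close> of \<open>\<sigma> (T i)\<close>.\<close>
  also have "\<dots> = (\<Oplus>i\<in>{..<n}. \<sigma> (g i \<otimes> T i) \<oplus> \<delta> (g i \<otimes> v i))"
  proof (rule finsum_cong')
    fix i assume "i \<in> {..<n}"
    then have c: "\<sigma> (g i) \<in> carrier R" "B i \<in> carrier R" "\<delta> (v i) \<in> carrier R"
      "\<delta> (g i) \<otimes> v i \<in> carrier R" and i: "i < n"
      using gc vc dc Bc by auto
    have "\<sigma> (g i \<otimes> T i) \<oplus> \<delta> (g i \<otimes> v i)
        = \<sigma> (g i) \<otimes> (B i \<oplus> \<ominus> \<delta> (v i)) \<oplus> (\<sigma> (g i) \<otimes> \<delta> (v i) \<oplus> \<delta> (g i) \<otimes> v i)"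
      using i gc vc Tc by (simp add: \<sigma>T dm)
    also have "\<dots> = \<sigma> (g i) \<otimes> B i \<oplus> \<delta> (g i) \<otimes> v i"
      using c by (simp add: r_distr r_minus a_assoc r_neg1)
    finally show "\<sigma> (g i) \<otimes> B i \<oplus> \<delta> (g i) \<otimes> v i = \<sigma> (g i \<otimes> T i) \<oplus> \<delta> (g i \<otimes> v i)" ..
  qed (use gc vc dc Tc in auto)
  also have "\<dots> = (\<Oplus>i\<in>{..<n}. \<sigma> (g i \<otimes> T i)) \<oplus> (\<Oplus>i\<in>{..<n}. \<delta> (g i \<otimes> v i))"
    by (rule finsum_addf) (use gc vc dc Tc in auto)
  also have "(\<Oplus>i\<in>{..<n}. \<sigma> (g i \<otimes> T i)) = \<sigma> (code_inner R n g T)"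
    unfolding code_inner_def
    by (rule additive_finsum[symmetric]) (use gc Tc in auto)
  also have "(\<Oplus>i\<in>{..<n}. \<delta> (g i \<otimes> v i)) = \<delta> (code_inner R n g v)"
    unfolding code_inner_def
    by (rule additive_finsum[symmetric])
      (use gc vc dc da left_skew_derivation_zero[OF d] in auto)
  finally show ?thesis
    by (simp add: T_def)
qed

section \<open>Invariance of the dual code under the sequential shift\<close>

lemma sequential_shift_dual_code:
  assumes iso: "\<sigma> \<in> ring_iso R R" and d: "left_skew_derivation R \<sigma> \<delta>" and f: "f \<in> up R"
    and C: "right_polycyclic_code R \<sigma> \<delta> n f C" and v: "v \<in> dual_code R n C"
  defines "\<sigma>' \<equiv> inv_into (carrier R) \<sigma>"
  shows "sequential_shift R \<sigma>' (\<lambda>a. \<ominus> \<sigma>' (\<delta> a)) n (map_coeffs R \<sigma>' f) v \<in> dual_code R n C"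
    (is "?T \<in> _")
proof -
  have hom: "\<sigma> \<in> ring_hom R R" and inj: "inj_on \<sigma> (carrier R)"
    using iso by (auto simp: ring_iso_def bij_betw_def)
  have hom': "\<sigma>' \<in> ring_hom R R"
    using ring_iso_set_sym[OF ring_axioms iso] by (simp add: \<sigma>'_def ring_iso_def)
  have vc: "v \<in> {..<n} \<rightarrow>\<^sub>E carrier R"
    using v by (simp add: dual_code_def)
  have Tc: "?T \<in> {..<n} \<rightarrow>\<^sub>E carrier R"
    using d map_coeffs_up[OF hom' f] vc ring_hom_closed[OF hom']
    by (intro sequential_shift_closed) (auto simp: left_skew_derivation_def Pi_iff)
  have "code_inner R n g ?T = \<zero>" if "g \<in> C" for g
  proof -
    have gc: "g \<in> {..<n} \<rightarrow>\<^sub>E carrier R"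
      using C that left_linear_code_subset[of R n C] by (auto simp: right_polycyclic_code_def)
    have c: "code_inner R n g ?T \<in> carrier R"
      unfolding code_inner_def by (rule finsum_closed) (use gc Tc in \<open>auto simp: PiE_iff\<close>)
    have "polycyclic_shift R \<sigma> \<delta> n f g \<in> C"
      using C that by (simp add: right_polycyclic_code_def)
    then have "code_inner R n (polycyclic_shift R \<sigma> \<delta> n f g) v = \<zero>" "code_inner R n g v = \<zero>"
      using v that by (simp_all add: dual_code_def)
    \<comment> \<open>In the adjointness identity the left-hand side and
      \<open>\<delta> \<zero>\<close> both vanish, which isolates the twisted pairing with the
      sequential shift.\<close>
    then have "\<sigma> (code_inner R n g ?T) = \<zero>"
      using code_inner_polycyclic_shift[OF iso d f gc vc] left_skew_derivation_zero[OF d]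
        ring_hom_closed[OF hom c] by (simp add: \<sigma>'_def)
    then show ?thesis
      using inj_onD[OF inj, of _ \<zero>] c ring_endo_zero[OF hom] by simp
  qed
  then show ?thesis
    using Tc by (simp add: dual_code_def)
qed

end

section \<open>Passage to the opposite ring and conclusion\<close>

theorem theorem2:
  fixes R :: "('a, 'm) ring_scheme"
    and R' :: "('a, 'm) ring_scheme"
    and \<sigma> \<delta> \<sigma>' \<delta>' :: "'a \<Rightarrow> 'a"
    and f f' :: "nat \<Rightarrow> 'a"
    and n :: nat
    and C :: "(nat \<Rightarrow> 'a) set"
  assumes "ring R" and "finite (carrier R)" and "\<one>\<^bsub>R\<^esub> \<noteq> \<zero>\<^bsub>R\<^esub>"
    and id_anti: "id \<in> ring_iso R (opposite_ring R)"
    and sigma_aut: "\<sigma> \<in> ring_iso R R"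
    and delta: "left_skew_derivation R \<sigma> \<delta>"
    and f_in_S: "f \<in> carrier (ore_extension R \<sigma> \<delta>)"
    and f_monic: "monic_of_degree R n f"
    and R'_eq: "R' = opposite_ring R"
    and sigma'_eq: "\<sigma>' = inv_into (carrier R) \<sigma>"
    and delta'_eq: "\<delta>' = (\<lambda>a. \<ominus>\<^bsub>R\<^esub> \<sigma>' (\<delta> a))"
    and f'_eq: "f' = map_coeffs R \<sigma>' f"
    and C_poly: "right_polycyclic_code R \<sigma> \<delta> n f C"
  shows "(\<forall>v \<in> dual_code R n C.
            vector_matrix_mult R n (map_vector n \<sigma>' v)
                (matrix_transpose (companion_matrix R n f'))
              \<oplus>\<^bsub>free_module R n\<^esub> map_vector n \<delta>' v \<in> dual_code R n C)
       \<and> (ring R' \<and> \<sigma>' \<in> ring_hom R' R' \<and> left_skew_derivation R' \<sigma>' \<delta>'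
          \<and> f' \<in> carrier (ore_extension R' \<sigma>' \<delta>') \<and> monic_of_degree R' n f')
       \<and> right_sequential_code R' \<sigma>' \<delta>' n f' (dual_code R n C)"
proof -
  interpret ring R by fact
  interpret cring R
    by (rule cring_if_id_iso_opposite) fact
  \<comment> \<open>The opposite ring is commutative as well, so linearity of dual codes is
    available over it.\<close>
  interpret op: cring "opposite_ring R"
    by (rule cring_opposite_ring)
  have f: "f \<in> up R"
    using f_in_S by (simp add: carrier_ore_extension)
  have iso': "\<sigma>' \<in> ring_iso R R"
    unfolding sigma'_eq by (rule ring_iso_set_sym[OF ring_axioms sigma_aut])
  then have hom': "\<sigma>' \<in> ring_hom R R"
    by (simp add: ring_iso_def)
  then have s': "\<sigma>' \<in> carrier R \<rightarrow> carrier R"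
    by (auto simp: ring_hom_closed)
  have f': "f' \<in> up R"
    using map_coeffs_up[OF hom' f] by (simp add: f'_eq)
  have C: "C \<subseteq> {..<n} \<rightarrow>\<^sub>E carrier R"
    using C_poly by (simp add: right_polycyclic_code_def left_linear_code_subset)
  have v: "v \<in> {..<n} \<rightarrow>\<^sub>E carrier R" if "v \<in> dual_code R n C" for v
    using that by (simp add: dual_code_def)
  \<comment> \<open>This one invariance serves both claims: on vectors of the dual, the
    companion-matrix map over \<open>R\<close> and the sequential shift over \<open>R'\<close> both
    equal this shift.\<close>
  have shift: "sequential_shift R \<sigma>' \<delta>' n f' v \<in> dual_code R n C" if "v \<in> dual_code R n C" for v
    using sequential_shift_dual_code[OF sigma_aut delta f C_poly that]
    by (simp add: f'_eq delta'_eq sigma'_eq)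
  \<comment> \<open>Linearity is wanted over \<open>R'\<close> for a dual formed over
    \<open>R\<close>; the two duals coincide.\<close>
  have "left_linear_code R' n (dual_code R n C)"
    using op.left_linear_code_dual_code[of C n] C dual_code_opposite_ring[OF C] by (simp add: R'_eq)
  then have "right_sequential_code R' \<sigma>' \<delta>' n f' (dual_code R n C)"
    using shift sequential_shift_opposite_ring[OF s' f' v]
    by (simp add: right_sequential_code_def R'_eq)
  moreover have "left_skew_derivation R' \<sigma>' \<delta>'"
    using left_skew_derivation_inverse[OF sigma_aut delta] by (simp add: R'_eq delta'_eq sigma'_eq)
  moreover have "monic_of_degree R' n f'"
    using monic_of_degree_map_coeffs[OF iso' f f_monic] by (simp add: R'_eq f'_eq)
  moreover have "f' \<in> carrier (ore_extension R' \<sigma>' \<delta>')"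
    using f' by (simp add: carrier_ore_extension R'_eq)
  moreover have "\<sigma>' \<in> ring_hom R' R'"
    using ring_hom_opposite_ring[OF hom'] by (simp add: R'_eq)
  moreover have "ring R'"
    unfolding R'_eq by (rule ring_opposite_ring)
  ultimately show ?thesis
    using shift sequential_shift_eq_companion_matrix[OF s' f' v] by simp
qed

end
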